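(* For every $n\ge 1$, the map $\varphi$ described in the context is a bijection between $\mathcal{A}^{(1)}_n$ and $\mathcal{W}_n$.
   Context: $\mathcal{S}_n$ is the set of permutations of $\{1,\dots,n\}$. $\mathcal{A}^{(1)}_n$ is the set of $\pi\in\mathcal{S}_n$ such that for every $i\in\{1,\dots,n\}$ there is at most one $j\le i$ with $\pi(j)>i$. $\mathcal{W}_n$ is the set of words of length $n-1$ over the four-letter alphabet $\{W,E,L,R\}$ that do not contain $LE$ or $RW$ in consecutive positions, and whose last letter is $W$ or $E$ (for $n=1$, $\mathcal{W}_1$ consists of the empty word only). Definition of $\varphi$. Given $\pi\in\mathcal{A}^{(1)}_n$, the word $\varphi(\pi)$ is built by reading the entries $\pi(1),\pi(2),\dots,\pi(n-1)$ from left to right, starting with $\pi(1)$ as the current entry and with the empty word. If $\pi(i)$ is the current entry, let $m=|\{j>i:\pi(j)<\pi(i)\}|$. - If $m=0$, append $W$. - If $m=1$, append $E$. - If $m\ge 2$, read also the next $m-1$ entries $\pi(j)$, $j=i+1,\dots,i+m-1$; for each of them in order append $R$ if $\pi(j)=j$ and append $L$ otherwise; then, if the letter appended for $\pi(i+m-1)$ was $R$, append $E$, and if it was $L$, append $W$. The entry immediately to the right of the last entry read becomes the new current entry. The process is repeated until $\pi(n-1)$ has been read (for $n=1$ the output is the empty word). *)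

theory Defs
  imports "HOL-Combinatorics.Permutations" "HOL-Library.Sublist"
begin

text \<open>Permutations of \<open>{1..n}\<close> are functions on \<^typ>\<open>nat\<close> that fix every point outside \<open>{1..n}\<close>.\<close>

definition A1 :: "nat \<Rightarrow> (nat \<Rightarrow> nat) set" where
  "A1 n = {p. p permutes {1..n} \<and> (\<forall>i\<in>{1..n}. card {j\<in>{1..n}. j \<le> i \<and> p j > i} \<le> 1)}"

datatype letter = W | E | L | R

definition words :: "nat \<Rightarrow> letter list set" where
  "words n = {w. length w = n - 1 \<and> \<not> sublist [L, E] w \<and> \<not> sublist [R, W] w \<and>
     (w \<noteq> [] \<longrightarrow> last w \<in> {W, E})}"

definition smaller_right :: "nat \<Rightarrow> (nat \<Rightarrow> nat) \<Rightarrow> nat \<Rightarrow> nat" where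
  "smaller_right n p i = card {j\<in>{1..n}. j > i \<and> p j < p i}"

definition fix_letter :: "(nat \<Rightarrow> nat) \<Rightarrow> nat \<Rightarrow> letter" where
  "fix_letter p j = (if p j = j then R else L)"

text \<open>\<open>phi_from n p i\<close> is the part of the word produced from the moment at which \<open>p i\<close> is the
  current entry. In the last case the entries \<open>i, \<dots>, i + m - 1\<close> are read, of which all but the
  first contribute to \<open>map (fix_letter p) [i+1..<i+m]\<close>.\<close>

function phi_from :: "nat \<Rightarrow> (nat \<Rightarrow> nat) \<Rightarrow> nat \<Rightarrow> letter list" where
  "phi_from n p i =
    (if i \<ge> n then []
     else let m = smaller_right n p i in
       if m = 0 then W # phi_from n p (i + 1)
       else if m = 1 then E # phi_from n p (i + 1)
       else map (fix_letter p) [i+1..<i+m] @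
            [if fix_letter p (i + m - 1) = R then E else W] @
            phi_from n p (i + m))"
  by pat_completeness auto
termination
  by (relation "measure (\<lambda>(n, p, i). n - i)") auto

declare phi_from.simps [simp del]

definition phi :: "nat \<Rightarrow> (nat \<Rightarrow> nat) \<Rightarrow> letter list" where
  "phi n p = phi_from n p 1"

end

(* Reading a permutation in A1 from left to right, the first j - 1 values are {1..j-1} with one
   value u exchanged for one value x \<ge> j; at a current entry x = j, so only u and the values above
   j are left, and m is 0 if the entry is u and (entry - j) otherwise. While x > j, membership in A1
   leaves just the two choices j (letter R) and u (letter L) for the next entry. Hence each letter
   determines the next entry, except that the entry opening a run of letters L and R equals its
   position plus the length of the run plus 1; this yields the inverse map. *)
theory Submission
  imports Defs
begin

section \<open>Words\<close>

text \<open>A recursive form of the word conditions, so that inductions can follow the decoding.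
  Requiring \<open>w \<noteq> []\<close> after \<open>L\<close> and \<open>R\<close> encodes that
  the last letter is \<open>W\<close> or \<open>E\<close>.\<close>

fun good :: "letter list \<Rightarrow> bool" where
  "good [] \<longleftrightarrow> True"
| "good (L # w) \<longleftrightarrow> w \<noteq> [] \<and> hd w \<noteq> E \<and> good w"
| "good (R # w) \<longleftrightarrow> w \<noteq> [] \<and> hd w \<noteq> W \<and> good w"
| "good (W # w) \<longleftrightarrow> good w"
| "good (E # w) \<longleftrightarrow> good w"

lemma good_iff:
  "good w \<longleftrightarrow> \<not> sublist [L, E] w \<and> \<not> sublist [R, W] w \<and> (w \<noteq> [] \<longrightarrow> last w \<in> {W, E})"
proof (induction w)
  case (Cons c w)
  then show ?case
    by (cases c; cases w) (auto simp: sublist_Cons_right)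
qed auto

lemma words_eq: "words n = {w. length w = n - 1 \<and> good w}"
  by (auto simp: words_def good_iff)

definition closing_letter :: "letter \<Rightarrow> letter" where
  "closing_letter c = (if c = R then E else W)"

text \<open>As \<open>LE\<close> and \<open>RW\<close> are forbidden, only one of \<open>W\<close>
  and \<open>E\<close> can follow the last letter of a block. The closing letter thus carries no
  information, and the decoder may skip it.\<close>

lemma good_append_run:
  assumes "ls \<noteq> []" "set ls \<subseteq> {L, R}" "c \<in> {W, E}"
  shows "good (ls @ c # w) \<longleftrightarrow> c = closing_letter (last ls) \<and> good w"
  using assms
proof (induction ls)
  case (Cons a ls)
  then show ?case
    by (cases a; cases ls; cases "hd ls") (auto simp: closing_letter_def)
qed auto

text \<open>At an entry that opens a block this length is \<open>m - 1\<close>, which is how the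
  decoder recovers the opening value.\<close>

definition run :: "letter list \<Rightarrow> nat" where
  "run w = length (takeWhile (\<lambda>c. c \<in> {L, R}) w)"

lemma run_simps [simp]:
  "run (L # w) = Suc (run w)" "run (R # w) = Suc (run w)" "run (W # w) = 0" "run (E # w) = 0"
  by (simp_all add: run_def)

lemma run_append: "set ls \<subseteq> {L, R} \<Longrightarrow> c \<in> {W, E} \<Longrightarrow> run (ls @ c # w) = length ls"
  by (induction ls) (auto simp: run_def)

lemma run_less_length: "good w \<Longrightarrow> w \<noteq> [] \<Longrightarrow> run w < length w"
  by (induction w rule: good.induct) auto

section \<open>The inverse map\<close>

text \<open>\<open>vals i u w\<close> lists the entries from position \<open>i\<close> on, where \<open>i\<close> is a current entry and \<open>u\<close>
  is the only value \<open>\<le> i\<close> not yet used; \<open>blk j u w\<close> does the same inside a block,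
  where position \<open>j\<close> is encoded by the first letter of \<open>w\<close>.\<close>

fun vals :: "nat \<Rightarrow> nat \<Rightarrow> letter list \<Rightarrow> nat list"
  and blk :: "nat \<Rightarrow> nat \<Rightarrow> letter list \<Rightarrow> nat list" where
  "vals i u [] = [u]"
| "vals i u (W # w) = u # vals (Suc i) (Suc i) w"
| "vals i u (E # w) = Suc i # vals (Suc i) u w"
| "vals i u (L # w) = (i + Suc (run (L # w))) # blk (Suc i) u (L # w)"
| "vals i u (R # w) = (i + Suc (run (R # w))) # blk (Suc i) u (R # w)"
| "blk j u [] = []"
| "blk j u (L # w) = u # blk (Suc j) j w"
| "blk j u (R # w) = j # blk (Suc j) u w"
| "blk j u (W # w) = vals j u w"
| "blk j u (E # w) = vals j u w"

lemma length_vals_blk: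
  "good w \<Longrightarrow> length (vals i u w) = Suc (length w)"
  "good v \<Longrightarrow> length (blk j x v) = length v"
  by (induction i u w and j x v rule: vals_blk.induct) auto

lemma insert_Suc_Ioc: "k < l \<Longrightarrow> insert (Suc k) {Suc k<..l} = {k<..l}"
  by (simp add: set_eq_iff) arith

lemma insert_Ico_minus: "j \<le> k \<Longrightarrow> k < l \<Longrightarrow> insert j ({Suc j..<l} - {Suc k}) = {j..<l} - {Suc k}"
  by (simp add: set_eq_iff) arith

text \<open>Shows that decoding produces every value exactly where a permutation needs one. Inside a
  block \<open>j + run v\<close> stays constant: it is the value that opened the block, hence no
  longer available.\<close>

lemma set_vals_blk:
  "good w \<Longrightarrow> set (vals i u w) = insert u {i<..i + length w}"
  "good v \<Longrightarrow> v \<noteq> [] \<Longrightarrow> set (blk j x v) = insert x ({j..<j + length v} - {j + run v})"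
proof (induction i u w and j x v rule: vals_blk.induct)
  case (2 i u w)
  then show ?case
    by (simp add: insert_Suc_Ioc)
next
  case (3 i u w)
  then show ?case
    by (simp add: insert_commute[of _ u] insert_Suc_Ioc)
next
  case (4 i u w)
  then have "run w < length w"
    by (intro run_less_length) auto
  then have "i + Suc (run (L # w)) \<in> {Suc i..<Suc i + length (L # w)}"
    by simp
  moreover have "{Suc i..<Suc i + length (L # w)} = {i<..i + length (L # w)}"
    by (simp add: set_eq_iff) arith
  moreover have "set (blk (Suc i) u (L # w)) =
      insert u ({Suc i..<Suc i + length (L # w)} - {Suc i + run (L # w)})"
    using 4 by blast
  ultimately show ?case
    by (simp only: vals.simps list.set add_Suc_right add_Suc) blast
next
  case (5 i u w)
  then have "run w < length w"
    by (intro run_less_length) auto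
  then have "i + Suc (run (R # w)) \<in> {Suc i..<Suc i + length (R # w)}"
    by simp
  moreover have "{Suc i..<Suc i + length (R # w)} = {i<..i + length (R # w)}"
    by (simp add: set_eq_iff) arith
  moreover have "set (blk (Suc i) u (R # w)) =
      insert u ({Suc i..<Suc i + length (R # w)} - {Suc i + run (R # w)})"
    using 5 by blast
  ultimately show ?case
    by (simp only: vals.simps list.set add_Suc_right add_Suc) blast
next
  case (7 j u w)
  then show ?case
    using run_less_length[of w] by (simp add: insert_Ico_minus)
next
  case (8 j u w)
  then show ?case
    using run_less_length[of w] by (simp add: insert_commute[of _ u] insert_Ico_minus)
next
  case (9 j u w)
  moreover have "insert u {j<..j + length w} = insert u ({j..<j + Suc (length w)} - {j})"
    by (simp add: set_eq_iff) arith
  ultimately show ?case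
    by simp
next
  case (10 j u w)
  moreover have "insert u {j<..j + length w} = insert u ({j..<j + Suc (length w)} - {j})"
    by (simp add: set_eq_iff) arith
  ultimately show ?case
    by simp
qed simp_all

section \<open>Reading a permutation\<close>

text \<open>At a current entry \<open>x = j\<close>; inside a block \<open>x\<close> is the value that opened it. The case
  \<open>u = x = j\<close> encodes that the prefix is a permutation of \<open>{1..<j}\<close>.\<close>

definition pstate :: "(nat \<Rightarrow> nat) \<Rightarrow> nat \<Rightarrow> nat \<Rightarrow> nat \<Rightarrow> bool" where
  "pstate p j u x \<longleftrightarrow> 1 \<le> j \<and> j \<le> x \<and> u \<le> j \<and> u \<in> insert x {1..<j} \<and>
     p ` {1..<j} = insert x {1..<j} - {u}"

lemma pstate_bounds:
  assumes "pstate p j u x"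
  shows "1 \<le> j" "1 \<le> u" "u \<le> j" "j \<le> x" "j < x \<Longrightarrow> u < j"
  using assms unfolding pstate_def by (simp_all, linarith+)

lemma pstate_image: "pstate p j u x \<Longrightarrow> p ` {1..<j} = insert x {1..<j} - {u}"
  by (simp add: pstate_def)

lemma pstate_init: "pstate p 1 1 1"
  by (auto simp: pstate_def)

text \<open>One transition per kind of letter: \<open>W\<close>; \<open>E\<close> or the opening of
  a block; \<open>L\<close>; \<open>R\<close>. After \<open>W\<close> the prefix is a permutation of
  \<open>{1..j}\<close>, so the state resets.\<close>

lemma pstate_step:
  assumes "pstate p j u x"
  shows "x = j \<Longrightarrow> p j = u \<Longrightarrow> pstate p (Suc j) (Suc j) (Suc j)"
    and "x = j \<Longrightarrow> p j > j \<Longrightarrow> pstate p (Suc j) u (p j)"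
    and "x > j \<Longrightarrow> p j = u \<Longrightarrow> pstate p (Suc j) j x"
    and "x > j \<Longrightarrow> p j = j \<Longrightarrow> pstate p (Suc j) u x"
proof -
  have *: "p ` {1..<Suc j} = insert (p j) (insert x {1..<j} - {u})"
    using pstate_bounds(1)[OF assms] pstate_image[OF assms] by (simp add: atLeastLessThanSuc)
  show "x = j \<Longrightarrow> p j = u \<Longrightarrow> pstate p (Suc j) (Suc j) (Suc j)"
    "x = j \<Longrightarrow> p j > j \<Longrightarrow> pstate p (Suc j) u (p j)"
    "x > j \<Longrightarrow> p j = u \<Longrightarrow> pstate p (Suc j) j x"
    "x > j \<Longrightarrow> p j = j \<Longrightarrow> pstate p (Suc j) u x"
    using pstate_bounds[OF assms] unfolding pstate_def * by auto
qed

lemma pstate_not_used: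
  assumes "inj p" "pstate p j u x" "j \<le> k"
  shows "p k = u \<or> (p k \<noteq> x \<and> p k \<notin> {1..<j})"
proof -
  have "p k \<notin> p ` {1..<j}"
    using assms by (auto simp: inj_eq)
  then show ?thesis
    using pstate_image[OF assms(2)] by blast
qed

lemma smaller_right_pstate:
  assumes p: "p permutes {1..n}" and st: "pstate p i u i" and "i \<le> n"
  shows "p i = u \<or> i < p i"
    and "smaller_right n p i = (if p i = u then 0 else p i - i)"
proof -
  note inj = permutes_inj[OF p]
  note bounds = pstate_bounds[OF st]
  have pos: "p k \<in> {1..n} \<longleftrightarrow> k \<in> {1..n}" for k
    using permutes_in_image[OF p] by blast
  have nu: "p k = u \<or> i < p k" if "i \<le> k" "k \<le> n" for k
  proof -
    have "1 \<le> p k"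
      using pos[of k] that bounds by simp
    then show ?thesis
      using pstate_not_used[OF inj st \<open>i \<le> k\<close>] by fastforce
  qed
  show pi: "p i = u \<or> i < p i"
    using nu \<open>i \<le> n\<close> by blast
  let ?S = "{j\<in>{1..n}. j > i \<and> p j < p i}"
  have "card ?S = (if p i = u then 0 else p i - i)"
  proof (cases "p i = u")
    case True
    have "\<not> p k < u" if "i < k" "k \<le> n" for k
      using nu[of k] that bounds by auto
    then have "?S = {}"
      using True by auto
    then show ?thesis
      using True by (simp only: card.empty if_True refl)
  next
    case False
    have less: "i < p i" and "p i \<le> n"
      using False pi pos[of i] bounds \<open>i \<le> n\<close> by auto
    have "p ` ?S = insert u {i<..<p i}"
    proof (intro equalityI subsetI)
      fix v assume "v \<in> p ` ?S"
      then obtain k where "v = p k" "i < k" "k \<le> n" "p k < p i"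
        by auto
      then show "v \<in> insert u {i<..<p i}"
        using nu[of k] by auto
    next
      fix v assume v: "v \<in> insert u {i<..<p i}"
      then have "v \<in> {1..n}" "v < p i"
        using bounds less \<open>p i \<le> n\<close> by auto
      moreover have "v \<notin> p ` {1..<i}"
        using v pstate_image[OF st] by auto
      moreover obtain k where k: "v = p k" "k \<in> {1..n}"
        using permutes_image[OF p] \<open>v \<in> {1..n}\<close> by blast
      ultimately have "k \<notin> {1..<i}" "k \<noteq> i"
        by auto
      then show "v \<in> p ` ?S"
        using k \<open>v < p i\<close> by auto
    qed
    then have "card ?S = card (insert u {i<..<p i})"
      using card_image[of p ?S] inj_on_subset[OF inj] by (metis (no_types, lifting) subset_UNIV)
    also have "\<dots> = p i - i"
      using less bounds by simp
    finally show ?thesis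
      using False by simp
  qed
  then show "smaller_right n p i = (if p i = u then 0 else p i - i)"
    by (simp add: smaller_right_def)
qed
text \<open>When \<open>p i\<close> is not \<open>u\<close>, \<open>m = p i - i\<close>, so the
  entries read end just before position \<open>p i\<close>, which holds the next current
  entry.\<close>

lemma phi_from_pstate:
  assumes "p permutes {1..n}" "pstate p i u i" "i < n"
  shows "p i = u \<Longrightarrow> phi_from n p i = W # phi_from n p (Suc i)"
    and "p i = Suc i \<Longrightarrow> phi_from n p i = E # phi_from n p (Suc i)"
    and "p i > Suc i \<Longrightarrow> phi_from n p i = map (fix_letter p) [Suc i..<p i] @
           closing_letter (last (map (fix_letter p) [Suc i..<p i])) # phi_from n p (p i)"
proof -
  have u: "u \<le> i"
    using pstate_bounds[OF assms(2)] by simp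
  note sr = smaller_right_pstate(2)[OF assms(1,2)]
  show "phi_from n p i = W # phi_from n p (Suc i)" if "p i = u"
    using sr that assms(3) by (subst phi_from.simps) (simp add: Let_def)
  show "phi_from n p i = E # phi_from n p (Suc i)" if "p i = Suc i"
    using sr that u assms(3) by (subst phi_from.simps) (simp add: Let_def)
  show "phi_from n p i = map (fix_letter p) [Suc i..<p i] @
      closing_letter (last (map (fix_letter p) [Suc i..<p i])) # phi_from n p (p i)"
    if "p i > Suc i"
  proof -
    have "i + (p i - i) = p i" "p i - i \<noteq> Suc 0" "p i \<noteq> u" "p i \<noteq> 0"
      using that u by auto
    then show ?thesis
      using sr that assms(3)
      by (subst phi_from.simps) (simp add: Let_def last_map closing_letter_def)
  qed
qed

lemma fix_letter_run: "set (map (fix_letter p) js) \<subseteq> {L, R}"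
  by (auto simp: fix_letter_def)

section \<open>The inverse map applied to the word of a permutation\<close>

lemma A1_pstate_cases:
  assumes "p \<in> A1 n" "pstate p j u x" "j \<le> n" "j < x"
  shows "p j = j \<or> p j = u"
proof (rule ccontr)
  assume neg: "\<not> (p j = j \<or> p j = u)"
  have p: "p permutes {1..n}"
    using assms by (simp add: A1_def)
  note inj = permutes_inj[OF p]
  have "p j \<in> {1..n}"
    using permutes_in_image[OF p, of j] pstate_bounds[OF assms(2)] assms(3) by simp
  then have "j < p j" "p j \<noteq> x"
    using pstate_not_used[OF inj assms(2), of j] neg by auto
  have "x \<in> p ` {1..<j}"
    using pstate_image[OF assms(2)] pstate_bounds[OF assms(2)] assms(4) by auto
  then obtain j' where j': "j' \<in> {1..<j}" "p j' = x"
    by blast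
  have "card {j', j} \<le> card {k\<in>{1..n}. k \<le> j \<and> p k > j}"
    using j' assms \<open>j < p j\<close> by (intro card_mono) auto
  moreover have "card {k\<in>{1..n}. k \<le> j \<and> p k > j} \<le> 1"
    using assms(1,3) pstate_bounds(1)[OF assms(2)] by (auto simp: A1_def)
  ultimately show False
    using j' by auto
qed

lemma blk_fix_letters:
  assumes "p \<in> A1 n" "x \<le> n" "c \<in> {W, E}"
    and "\<And>u. pstate p x u x \<Longrightarrow> vals x u w = map p [x..<Suc n]"
    and "pstate p j u x"
  shows "blk j u (map (fix_letter p) [j..<x] @ c # w) = map p [j..<Suc n]"
  using assms(5)
proof (induction "x - j" arbitrary: j u)
  case 0
  then have "x = j"
    using pstate_bounds(4)[OF 0(2)] by simp
  then show ?case
    using 0 assms(3,4) by auto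
next
  case (Suc d)
  then have "j < x"
    by simp
  then have upt: "[j..<x] = j # [Suc j..<x]" "[j..<Suc n] = j # [Suc j..<Suc n]"
    using \<open>x \<le> n\<close> by (auto intro!: upt_conv_Cons simp del: upt_Suc)
  have u: "u < j"
    using pstate_bounds(5)[OF Suc.prems \<open>j < x\<close>] .
  have "p j = j \<or> p j = u"
    using A1_pstate_cases[OF assms(1) Suc.prems] \<open>j < x\<close> \<open>x \<le> n\<close> by auto
  then show ?case
  proof
    assume "p j = j"
    then show ?thesis
      using Suc.hyps(1)[OF _ pstate_step(4)[OF Suc.prems \<open>j < x\<close>]] Suc.hyps(2) u
      by (simp add: upt fix_letter_def del: upt_Suc)
  next
    assume "p j = u"
    then show ?thesis
      using Suc.hyps(1)[OF _ pstate_step(3)[OF Suc.prems \<open>j < x\<close>]] Suc.hyps(2) u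
      by (simp add: upt fix_letter_def del: upt_Suc)
  qed
qed

text \<open>Decoding is a left inverse of encoding on \<open>A1\<close>. The induction is strong
  because a block moves the current position from \<open>i\<close> to \<open>p i\<close>.\<close>

lemma vals_phi_from:
  assumes "p \<in> A1 n" "pstate p i u i" "i \<le> n"
  shows "good (phi_from n p i) \<and> length (phi_from n p i) = n - i \<and>
    vals i u (phi_from n p i) = map p [i..<Suc n]"
  using assms(2,3)
proof (induction "n - i" arbitrary: i u rule: less_induct)
  case less
  have p: "p permutes {1..n}"
    using assms by (simp add: A1_def)
  note pi = smaller_right_pstate(1)[OF p less.prems]
  have "1 \<le> i" "u \<le> i"
    using pstate_bounds[OF less.prems(1)] by simp_all
  then have pin: "p i \<le> n"
    using permutes_in_image[OF p, of i] less.prems by auto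
  have upt: "[i..<Suc n] = i # [Suc i..<Suc n]"
    using less.prems by (auto intro!: upt_conv_Cons simp del: upt_Suc)
  show ?case
  proof (cases "i = n")
    case True
    then show ?thesis
      using pi pin by (subst (1 2 3) phi_from.simps) auto
  next
    case False
    then have "i < n"
      using less.prems by simp
    note phi = phi_from_pstate[OF p less.prems(1) \<open>i < n\<close>]
    consider "p i = u" | "p i = Suc i" | "p i > Suc i"
      using pi by linarith
    then show ?thesis
    proof cases
      case 1
      then show ?thesis
        using less.hyps[OF _ pstate_step(1)[OF less.prems(1)]] \<open>i < n\<close>
        by (simp add: phi upt del: upt_Suc)
    next
      case 2
      then show ?thesis
        using less.hyps[of "Suc i" u] pstate_step(2)[OF less.prems(1)] \<open>i < n\<close>
        by (simp add: phi upt del: upt_Suc)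
    next
      case 3
      define ls where "ls = map (fix_letter p) [Suc i..<p i]"
      define c where "c = closing_letter (last ls)"
      have eq: "phi_from n p i = ls @ c # phi_from n p (p i)"
        using phi(3)[OF 3] by (simp add: ls_def c_def)
      have ls: "set ls \<subseteq> {L, R}" "ls \<noteq> []"
        using fix_letter_run 3 unfolding ls_def by (blast, simp)
      have c: "c \<in> {W, E}"
        by (simp add: c_def closing_letter_def)
      have st: "pstate p (Suc i) u (p i)"
        using pstate_step(2)[OF less.prems(1)] 3 by simp
      have IH: "good (phi_from n p (p i)) \<and> length (phi_from n p (p i)) = n - p i \<and>
          vals (p i) v (phi_from n p (p i)) = map p [p i..<Suc n]"
        if "pstate p (p i) v (p i)" for v
        using less.hyps[OF _ that] 3 pin by simp
      \<comment> \<open>Goodness and length do not involve \<open>v\<close>, but extracting them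
        from \<open>IH\<close> needs some state at \<open>p i\<close>; it is reached by stepping
        through the block.\<close>
      obtain v where v: "pstate p (p i) v (p i)"
      proof -
        have "\<exists>v. pstate p k v (p i)" if "Suc i \<le> k" "k \<le> p i" for k
          using that
        proof (induction k rule: dec_induct)
          case (step k)
          then obtain v where v: "pstate p k v (p i)"
            by auto
          then show ?case
            using A1_pstate_cases[OF assms(1) v] pstate_step(3,4)[OF v] step.prems pin by force
        qed (use st in blast)
        from this[of "p i"] show ?thesis
          using 3 that by auto
      qed
      have "blk (Suc i) u (ls @ c # phi_from n p (p i)) = map p [Suc i..<Suc n]"
        unfolding ls_def using IH by (intro blk_fix_letters[OF assms(1) pin c _ st]) auto
      moreover have "vals i u (ls @ c # phi_from n p (p i)) =
          (i + Suc (length ls)) # blk (Suc i) u (ls @ c # phi_from n p (p i))"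
        using ls run_append[OF ls(1) c] by (cases ls) auto
      ultimately have "vals i u (phi_from n p i) = map p [i..<Suc n]"
        using 3 by (simp add: eq upt ls_def del: upt_Suc)
      moreover have "good (phi_from n p i)"
        using good_append_run[OF ls(2,1) c] IH[OF v] by (simp add: eq c_def)
      ultimately show ?thesis
        using IH[OF v] 3 pin by (simp add: eq ls_def)
    qed
  qed
qed

section \<open>The word of the decoded permutation\<close>

text \<open>The condition of \<open>A1\<close> at a single index, to be collected position by
  position during decoding.\<close>

definition low_excess :: "nat \<Rightarrow> (nat \<Rightarrow> nat) \<Rightarrow> nat \<Rightarrow> bool" where
  "low_excess n p k \<longleftrightarrow> card {j\<in>{1..n}. j \<le> k \<and> p j > k} \<le> 1"

lemma ball_Icc_Suc: "(i::nat) \<le> n \<Longrightarrow> (\<forall>k\<in>{i..n}. P k) \<longleftrightarrow> P i \<and> (\<forall>k\<in>{Suc i..n}. P k)"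
  by (simp add: Icc_eq_insert_lb_nat)

text \<open>All values in the first \<open>k\<close> positions except possibly \<open>x\<close> are
  at most \<open>k\<close>, so only the preimage of \<open>x\<close> can count.\<close>

lemma pstate_low_excess:
  assumes "inj p" "pstate p (Suc k) u x"
  shows "low_excess n p k"
proof -
  let ?S = "{j\<in>{1..n}. j \<le> k \<and> p j > k}"
  have "p j = x" if "j \<in> ?S" for j
  proof -
    have "p j \<in> p ` {1..<Suc k}"
      using that by simp
    then have "p j \<in> insert x {1..<Suc k}"
      unfolding pstate_image[OF assms(2)] by blast
    then show ?thesis
      using that by simp
  qed
  then have "p ` ?S \<subseteq> {x}"
    by blast
  then have "card ?S \<le> card {x}"
    using inj_on_subset[OF assms(1)] by (intro card_inj_on_le[of p]) auto
  then show ?thesis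
    unfolding low_excess_def by simp
qed

text \<open>Shared by the opening letters \<open>L\<close> and \<open>R\<close>. The block
  hypothesis only provides some \<open>c\<close>; goodness of the whole word identifies it as the
  closing letter.\<close>

lemma current_run:
  assumes p: "p permutes {1..n}" and st: "pstate p i u i" and "i < n" "good w"
    and pi: "p i = i + Suc (run w)" and "run w > 0"
    and IH: "(\<exists>c\<in>{W, E}. w = map (fix_letter p) [Suc i..<Suc i + run w] @ c # phi_from n p (Suc i + run w)) \<and>
        (\<forall>k\<in>{Suc i..n}. low_excess n p k)"
  shows "phi_from n p i = w \<and> (\<forall>k\<in>{i..n}. low_excess n p k)"
proof -
  define ls where "ls = map (fix_letter p) [Suc i..<p i]"
  have ls: "ls \<noteq> []" "set ls \<subseteq> {L, R}"
    using pi \<open>run w > 0\<close> fix_letter_run unfolding ls_def by (simp, blast)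
  have "Suc i + run w = p i" "p i > Suc i"
    using pi \<open>run w > 0\<close> by simp_all
  then obtain c where c: "c \<in> {W, E}" and w: "w = ls @ c # phi_from n p (p i)"
    using IH unfolding ls_def by metis
  have "c = closing_letter (last ls)"
    using good_append_run[OF ls c] \<open>good w\<close> w by metis
  then have "phi_from n p i = w"
    using phi_from_pstate(3)[OF p st \<open>i < n\<close> \<open>p i > Suc i\<close>] w unfolding ls_def by metis
  moreover have "low_excess n p i"
    using pstate_low_excess[OF permutes_inj[OF p] pstate_step(2)[OF st]] pi by simp
  ultimately show ?thesis
    using IH \<open>i < n\<close> by (simp add: ball_Icc_Suc[of i n])
qed

text \<open>Encoding is a left inverse of decoding, and the decoded permutation satisfies the
  condition of \<open>A1\<close>. The length equations differ by one because the closing letter of a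
  block consumes no entry of its own.\<close>

lemma phi_from_vals_blk:
  assumes p: "p permutes {1..n}"
  shows "\<lbrakk>pstate p i u i; good w; length w + i = n; vals i u w = map p [i..<Suc n]\<rbrakk>
      \<Longrightarrow> phi_from n p i = w \<and> (\<forall>k\<in>{i..n}. low_excess n p k)"
    and "\<lbrakk>pstate p j v (j + run w'); good w'; w' \<noteq> []; length w' + j = Suc n;
       blk j v w' = map p [j..<Suc n]\<rbrakk>
      \<Longrightarrow> (\<exists>c\<in>{W, E}. w' = map (fix_letter p) [j..<j + run w'] @ c # phi_from n p (j + run w')) \<and>
        (\<forall>k\<in>{j..n}. low_excess n p k)"
proof (induction i u w and j v w' rule: vals_blk.induct)
  case (1 i u)
  have "p j \<le> n" if "j \<in> {1..n}" for j
    using permutes_in_image[OF p, of j] that by simp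
  then have "{j\<in>{1..n}. j \<le> n \<and> p j > n} = {}"
    by (auto simp: not_less)
  then have "low_excess n p n"
    unfolding low_excess_def by (simp only: card.empty zero_le)
  moreover have "i = n"
    using 1 by simp
  ultimately show ?case
    by (subst phi_from.simps) simp
next
  case (2 i u w)
  then have upt: "[i..<Suc n] = i # [Suc i..<Suc n]" and "i < n"
    by (auto intro!: upt_conv_Cons simp del: upt_Suc)
  have pi: "p i = u"
    using "2.prems"(4) by (simp add: upt del: upt_Suc)
  then have st: "pstate p (Suc i) (Suc i) (Suc i)"
    using pstate_step(1)[OF "2.prems"(1)] by simp
  show ?case
    using "2.IH"[OF st] "2.prems" pstate_low_excess[OF permutes_inj[OF p] st, of n] \<open>i < n\<close>
      phi_from_pstate(1)[OF p "2.prems"(1) \<open>i < n\<close> pi]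
    by (simp add: upt ball_Icc_Suc[of i n] del: upt_Suc)
next
  case (3 i u w)
  then have upt: "[i..<Suc n] = i # [Suc i..<Suc n]" and "i < n"
    by (auto intro!: upt_conv_Cons simp del: upt_Suc)
  have pi: "p i = Suc i"
    using "3.prems"(4) by (simp add: upt del: upt_Suc)
  have tl: "vals (Suc i) u w = map p [Suc i..<Suc n]"
    using arg_cong[OF "3.prems"(4), of tl] by (simp add: upt del: upt_Suc)
  have st: "pstate p (Suc i) u (Suc i)"
    using pstate_step(2)[OF "3.prems"(1)] pi by simp
  show ?case
    using "3.IH"[OF st _ _ tl] "3.prems"(2,3) pstate_low_excess[OF permutes_inj[OF p] st, of n] \<open>i < n\<close>
      phi_from_pstate(2)[OF p "3.prems"(1) \<open>i < n\<close> pi]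
    by (simp add: ball_Icc_Suc[of i n])
next
  case (4 i u w)
  then have upt: "[i..<Suc n] = i # [Suc i..<Suc n]" and "i < n"
    by (auto intro!: upt_conv_Cons simp del: upt_Suc)
  have pi: "p i = i + Suc (run (L # w))"
    using "4.prems"(4) by (simp add: upt del: upt_Suc)
  then have st: "pstate p (Suc i) u (Suc i + run (L # w))"
    using pstate_step(2)[OF "4.prems"(1)] by simp
  show ?case
    using "4.prems" "4.IH"[OF st]
    by (intro current_run[OF p "4.prems"(1) _ _ pi]) (auto simp: upt simp del: upt_Suc)
next
  case (5 i u w)
  then have upt: "[i..<Suc n] = i # [Suc i..<Suc n]" and "i < n"
    by (auto intro!: upt_conv_Cons simp del: upt_Suc)
  have pi: "p i = i + Suc (run (R # w))"
    using "5.prems"(4) by (simp add: upt del: upt_Suc)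
  then have st: "pstate p (Suc i) u (Suc i + run (R # w))"
    using pstate_step(2)[OF "5.prems"(1)] by simp
  show ?case
    using "5.prems" "5.IH"[OF st]
    by (intro current_run[OF p "5.prems"(1) _ _ pi]) (auto simp: upt simp del: upt_Suc)
next
  case (7 j u w)
  then have upt: "[j..<Suc n] = j # [Suc j..<Suc n]" "[j..<Suc (j + run w)] = j # [Suc j..<Suc (j + run w)]"
    and "j \<le> n" and less: "j < j + run (L # w)"
    by (auto intro!: upt_conv_Cons simp del: upt_Suc)
  have pj: "p j = u"
    using "7.prems"(5) by (simp add: upt del: upt_Suc)
  have st: "pstate p (Suc j) j (Suc j + run w)"
    using pstate_step(3)[OF "7.prems"(1) less pj] by simp
  \<comment> \<open>The block is still open, so \<open>u < j\<close> and the entry cannot be a fixed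
    point.\<close>
  have "fix_letter p j = L"
    using pj pstate_bounds(5)[OF "7.prems"(1) less] by (simp add: fix_letter_def)
  then show ?case
    using "7.IH"[OF st] "7.prems" pstate_low_excess[OF permutes_inj[OF p] st, of n] \<open>j \<le> n\<close>
    by (simp add: upt ball_Icc_Suc[of j n] del: upt_Suc)
next
  case (8 j u w)
  then have upt: "[j..<Suc n] = j # [Suc j..<Suc n]" "[j..<Suc (j + run w)] = j # [Suc j..<Suc (j + run w)]"
    and "j \<le> n" and less: "j < j + run (R # w)"
    by (auto intro!: upt_conv_Cons simp del: upt_Suc)
  have pj: "p j = j"
    using "8.prems"(5) by (simp add: upt del: upt_Suc)
  have tl: "blk (Suc j) u w = map p [Suc j..<Suc n]"
    using arg_cong[OF "8.prems"(5), of tl] by (simp add: upt del: upt_Suc)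
  have st: "pstate p (Suc j) u (Suc j + run w)"
    using pstate_step(4)[OF "8.prems"(1) less pj] by simp
  have "fix_letter p j = R"
    using pj by (simp add: fix_letter_def)
  then show ?case
    using "8.IH"[OF st _ _ _ tl] "8.prems"(2,4) pstate_low_excess[OF permutes_inj[OF p] st, of n] \<open>j \<le> n\<close>
    by (simp add: upt ball_Icc_Suc[of j n] del: upt_Suc)
next
  case (6 j u)
  then show ?case
    by blast
next
  case (9 j u w)
  \<comment> \<open>The block has ended: \<open>run\<close> is 0, position \<open>j\<close> is a
    current entry again, and the letter read is the witness \<open>c\<close>.\<close>
  have "phi_from n p j = w \<and> (\<forall>k\<in>{j..n}. low_excess n p k)"
    using "9.IH" "9.prems" by (simp del: upt_Suc)
  then show ?case
    by simp
next
  case (10 j u w)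
  have "phi_from n p j = w \<and> (\<forall>k\<in>{j..n}. low_excess n p k)"
    using "10.IH" "10.prems" by (simp del: upt_Suc)
  then show ?case
    by simp
qed

section \<open>Combining both inverse statements into the bijection\<close>

theorem proposition4p1:
  fixes n :: nat
  assumes "n \<ge> 1"
  shows "bij_betw (phi n) (A1 n) (words n)"
proof (intro bij_betw_imageI)
  \<comment> \<open>This yields both injectivity, by recovering the entries, and membership of the
    image in \<open>words n\<close>.\<close>
  have dec: "good (phi n p) \<and> length (phi n p) = n - 1 \<and> vals 1 1 (phi n p) = map p [1..<Suc n]"
    if "p \<in> A1 n" for p
    using vals_phi_from[OF that pstate_init assms] by (simp add: phi_def)
  show "inj_on (phi n) (A1 n)"
  proof (rule inj_onI)
    fix p q assume pq: "p \<in> A1 n" "q \<in> A1 n" "phi n p = phi n q"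
    then have "map p [1..<Suc n] = map q [1..<Suc n]"
      using dec by metis
    then have "p k = q k" if "k \<in> {1..n}" for k
      using that by (auto simp del: upt_Suc)
    moreover have "p permutes {1..n}" "q permutes {1..n}"
      using pq by (auto simp: A1_def)
    ultimately show "p = q"
      by (metis ext permutes_not_in)
  qed
  show "phi n ` A1 n = words n"
  proof (intro equalityI subsetI)
    fix w assume "w \<in> words n"
    then have w: "good w" "length w + 1 = n"
      using assms by (auto simp: words_eq)
    define xs where "xs = vals 1 1 w"
    have len: "length xs = n"
      using w length_vals_blk(1)[of w 1 1] by (simp add: xs_def)
    have set: "set xs = {1..n}"
      using set_vals_blk(1)[OF w(1), of 1 1] ivl_disj_un_singleton(5)[of 1 n] w(2) assms
      by (simp add: xs_def)
    \<comment> \<open>The list is indexed from 0 and positions start at 1; points outside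
      \<open>{1..n}\<close> must be fixed.\<close>
    define p where "p k = (if k \<in> {1..n} then xs ! (k - 1) else k)" for k
    have map: "map p [1..<Suc n] = xs"
      using len by (intro nth_equalityI) (auto simp: p_def simp del: upt_Suc)
    have "p ` {1..n} = {1..n}"
      using set arg_cong[OF map, of set] by (simp add: atLeastLessThanSuc_atLeastAtMost del: upt_Suc)
    then have p: "p permutes {1..n}"
      by (intro bij_imp_permutes) (auto simp: bij_betw_def p_def intro: eq_card_imp_inj_on)
    have "phi n p = w \<and> (\<forall>k\<in>{1..n}. low_excess n p k)"
      using phi_from_vals_blk(1)[OF p pstate_init w] map by (simp add: phi_def xs_def del: upt_Suc)
    then show "w \<in> phi n ` A1 n"
      using p by (auto simp: A1_def low_excess_def)
  next
    fix w assume "w \<in> phi n ` A1 n"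
    then show "w \<in> words n"
      using dec unfolding words_eq by blast
  qed
qed

end
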